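(* Let $m\geqslant2$, and let $$\varphi(z)=(zf_1(z)+a_1)^{e_1}(zf_2(z)+a_2)^{e_2}\cdots(zf_m(z)+a_m)^{e_m},$$ where $a_1,a_2,\ldots,a_m$ are integers with $|a_j|\geqslant2$ for some $j$. Assume that, for $i=1,2,\ldots,m$, $e_i\geqslant2$ is an integer and $f_i(z)\in\mathbb{Z}[z]$ has no integer roots. Then: (1) $0$ is a preperiodic point of $\varphi$ if and only if $0$ is a fixed point of $\varphi$. (2) If $0$ is a wandering point of $\varphi$, then the Zsigmondy set $\mathcal{Z}(\{\varphi^n(0)\}_{n\geqslant1})$ is empty.
   Context: $\varphi^n$ denotes the $n$-th iterate of $\varphi$. A point is a wandering point of $\varphi$ if its forward orbit under $\varphi$ is infinite; otherwise it is a preperiodic point. For a sequence of integers $\mathcal{A}=\{A_n\}_{n\geqslant1}$, a prime $p$ is a primitive divisor of $A_n$ if $p\mid A_n$ and $p\nmid A_i$ for all $1\leqslant i<n$; the Zsigmondy set is $\mathcal{Z}(\mathcal{A})=\{n\geqslant1 : A_n\text{ does not have a primitive divisor}\}$. *)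

theory Defs
  imports "HOL-Computational_Algebra.Computational_Algebra"
begin

definition forward_orbit :: "('a \<Rightarrow> 'a) \<Rightarrow> 'a \<Rightarrow> 'a set" where
  "forward_orbit \<phi> x = range (\<lambda>n. (\<phi> ^^ n) x)"

definition wandering_point :: "('a \<Rightarrow> 'a) \<Rightarrow> 'a \<Rightarrow> bool" where
  "wandering_point \<phi> x \<longleftrightarrow> infinite (forward_orbit \<phi> x)"

definition preperiodic_point :: "('a \<Rightarrow> 'a) \<Rightarrow> 'a \<Rightarrow> bool" where
  "preperiodic_point \<phi> x \<longleftrightarrow> \<not> wandering_point \<phi> x"

definition fixed_point :: "('a \<Rightarrow> 'a) \<Rightarrow> 'a \<Rightarrow> bool" where
  "fixed_point \<phi> x \<longleftrightarrow> \<phi> x = x"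

text \<open>
  Sequences are indexed from 1; the value at 0 is never inspected.
\<close>

definition primitive_divisor :: "(nat \<Rightarrow> int) \<Rightarrow> nat \<Rightarrow> nat \<Rightarrow> bool" where
  "primitive_divisor A n p \<longleftrightarrow>
     prime p \<and> int p dvd A n \<and> (\<forall>i. 1 \<le> i \<and> i < n \<longrightarrow> \<not> int p dvd A i)"

definition zsigmondy_set :: "(nat \<Rightarrow> int) \<Rightarrow> nat set" where
  "zsigmondy_set A = {n. n \<ge> 1 \<and> \<not> (\<exists>p. primitive_divisor A n p)}"

end

theory Submission
  imports Defs
begin

text \<open>
  Write \<open>A n = \<phi>^n(0)\<close> for \<open>n \<ge> 1\<close>, so that \<open>A 1\<close> is the product of the \<open>a i ^ e i\<close>. If it vanishes, \<open>0\<close> is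
  fixed and both claims are trivial. Otherwise the proof plays arithmetic against growth.

  Arithmetic: because all exponents are at least 2, the orbit of \<open>0\<close> is rigidly divisible, that
  is, the multiplicity of a prime \<open>p\<close> is the same in all the \<open>A n\<close> that \<open>p\<close> divides
  (\<open>multiplicity_orbit_of_zero\<close>). Hence a term \<open>A n\<close> without primitive divisor divides the
  product of all earlier terms (\<open>orbit_dvd_prod_if_no_primitive_divisor\<close>).

  Growth: all \<open>a i\<close> are now nonzero, one of them exceeds 1 in absolute value, and all exponents
  are at least 2, so \<open>\<bar>A 1\<bar> \<ge> 4\<close> and \<open>(a i)\<^sup>2 \<le> \<bar>A 1\<bar>\<close> for every \<open>i\<close>. Whenever
  \<open>\<bar>x\<bar> \<ge> \<bar>A 1\<bar>\<close>, each of the at least two factors \<open>(x f i(x) + a i) ^ e i\<close> has absolute value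
  at least \<open>\<bar>x\<bar>\<close> (\<open>square_ge_of_nonzero_multiple\<close>, where \<open>f i(x) \<noteq> 0\<close> enters), so
  \<open>\<bar>\<phi>(x)\<bar> \<ge> x\<^sup>2\<close>. Thus \<open>\<bar>A n\<bar>\<close> increases strictly, which makes \<open>0\<close> a wandering point, and
  \<open>\<bar>A (n + 1)\<bar> \<ge> (A n)\<^sup>2\<close> forces \<open>A n\<close> to exceed the product of all earlier terms
  (\<open>prod_less_of_square_growth\<close>). It therefore cannot divide that product, and \<open>A n\<close> has a
  primitive divisor.
\<close>

section \<open>Rigid divisibility of the orbit of zero\<close>

lemma poly_diff_dvd:
  fixes F :: "'a::comm_ring_1 poly"
  assumes "d dvd x - y"
  shows "d dvd poly F x - poly F y"
proof (induction F)
  case 0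
  show ?case by simp
next
  case (pCons b F)
  have "poly (pCons b F) x - poly (pCons b F) y
      = x * (poly F x - poly F y) + (x - y) * poly F y"
    by (simp add: algebra_simps)
  with assms pCons.IH show ?case by simp
qed

lemma funpow_poly_diff_dvd:
  fixes F :: "'a::comm_ring_1 poly"
  assumes "d dvd x - y"
  shows "d dvd (poly F ^^ n) x - (poly F ^^ n) y"
  by (induction n) (use assms in \<open>simp_all add: poly_diff_dvd\<close>)

lemma multiplicity_eq_of_diff_dvd:
  fixes p x y :: int
  assumes p: "prime p" and "x \<noteq> 0"
    and diff: "p ^ Suc (multiplicity p x) dvd x - y"
  shows "multiplicity p y = multiplicity p x"
proof (rule multiplicity_eqI)
  have "p ^ multiplicity p x dvd x - y"
    using diff by (rule power_le_dvd) simp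
  with multiplicity_dvd have "p ^ multiplicity p x dvd x - (x - y)"
    by (rule dvd_diff)
  also have "x - (x - y) = y"
    by simp
  finally show "p ^ multiplicity p x dvd y" .
  have "\<not> p ^ Suc (multiplicity p x) dvd x"
    using p \<open>x \<noteq> 0\<close> by (subst power_dvd_iff_le_multiplicity) (auto dest: not_prime_unit)
  moreover have "p ^ Suc (multiplicity p x) dvd x" if "p ^ Suc (multiplicity p x) dvd y"
    using dvd_add[OF diff that] by simp
  ultimately show "\<not> p ^ Suc (multiplicity p x) dvd y"
    by blast
qed

text \<open>
  Each factor divides the product at least twice, so its multiplicity at \<open>p\<close> is at most half of
  that of the product, which is positive, and hence strictly smaller. A congruence modulo the full power of \<open>p\<close> in
  the product therefore pins down the multiplicity of every single factor. With an exponent 1 this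
  fails: 2 and 4 are congruent modulo 2 but have different multiplicities at 2.
\<close>

lemma multiplicity_prod_powers_cong:
  fixes p :: int and x y :: "'i \<Rightarrow> int"
  assumes p: "prime p" and "finite I"
    and e: "\<And>i. i \<in> I \<Longrightarrow> 2 \<le> e i"
    and nz: "(\<Prod>i\<in>I. x i ^ e i) \<noteq> 0" "(\<Prod>i\<in>I. y i ^ e i) \<noteq> 0"
    and dvd: "p dvd (\<Prod>i\<in>I. x i ^ e i)"
    and diff: "\<And>i. i \<in> I \<Longrightarrow> p ^ multiplicity p (\<Prod>i\<in>I. x i ^ e i) dvd x i - y i"
  shows "multiplicity p (\<Prod>i\<in>I. y i ^ e i) = multiplicity p (\<Prod>i\<in>I. x i ^ e i)"
proof -
  define v where "v = multiplicity p (\<Prod>i\<in>I. x i ^ e i)"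
  have nz': "x i \<noteq> 0" "y i \<noteq> 0" if "i \<in> I" for i
    using nz that e[OF that] \<open>finite I\<close> by auto
  have sum: "multiplicity p (\<Prod>i\<in>I. z i ^ e i) = (\<Sum>i\<in>I. e i * multiplicity p (z i))"
    if "\<And>i. i \<in> I \<Longrightarrow> z i \<noteq> 0" for z :: "'i \<Rightarrow> int"
    using p \<open>finite I\<close> that
    by (subst prime_elem_multiplicity_prod_distrib)
       (auto simp: prime_elem_multiplicity_power_distrib)
  have "v > 0"
    unfolding v_def using dvd nz p by (intro prime_multiplicity_gt_zero_iff[THEN iffD2]) auto
  have "multiplicity p (y i) = multiplicity p (x i)" if i: "i \<in> I" for i
  proof -
    have "e i * multiplicity p (x i) \<le> v"
      unfolding v_def using sum[OF nz'(1)] member_le_sum[OF i, of "\<lambda>i. e i * multiplicity p (x i)"]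
        \<open>finite I\<close> by simp
    moreover have "2 * multiplicity p (x i) \<le> e i * multiplicity p (x i)"
      using e[OF i] by (rule mult_right_mono) simp
    ultimately have "Suc (multiplicity p (x i)) \<le> v"
      using \<open>v > 0\<close> by linarith
    then have "p ^ Suc (multiplicity p (x i)) dvd x i - y i"
      using diff[OF i] unfolding v_def by (meson dvd_trans le_imp_power_dvd)
    then show ?thesis
      by (rule multiplicity_eq_of_diff_dvd[OF p nz'(1)[OF i]])
  qed
  then show ?thesis
    using nz' by (simp add: sum)
qed

text \<open>
  Rigid divisibility of the orbit \<open>A n = F^n(0)\<close>: once \<open>p\<close> has entered the sequence, at index
  \<open>k\<close>, it always reappears with the same multiplicity \<open>v\<close>. Indeed, \<open>A k \<equiv> 0\<close> modulo \<open>p\<close>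
  restarts the orbit modulo \<open>p\<close>, so \<open>p\<close> divides \<open>A n\<close> only if it divides \<open>A (n - k)\<close>. If
  \<open>A (n - k) \<equiv> 0\<close> modulo \<open>p ^ v\<close>, then the orbit restarts modulo \<open>p ^ v\<close> as well, whence
  \<open>A (n - 1) \<equiv> A (k - 1)\<close> modulo \<open>p ^ v\<close>; one more application of \<open>F\<close>, a product of powers
  with exponents at least 2, turns this congruence into an equality of multiplicities.
\<close>

lemma multiplicity_orbit_of_zero:
  fixes p :: int and g :: "'i \<Rightarrow> int poly" and F :: "int poly"
  assumes p: "prime p" and "finite I"
    and e: "\<And>i. i \<in> I \<Longrightarrow> 2 \<le> e i"
    and F: "F = (\<Prod>i\<in>I. g i ^ e i)"
    and nz: "\<And>n. 1 \<le> n \<Longrightarrow> (poly F ^^ n) 0 \<noteq> 0"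
    and k: "1 \<le> k" "p dvd (poly F ^^ k) 0"
    and min: "\<And>i. 1 \<le> i \<Longrightarrow> i < k \<Longrightarrow> \<not> p dvd (poly F ^^ i) 0"
    and n: "1 \<le> n" "p dvd (poly F ^^ n) 0"
  shows "multiplicity p ((poly F ^^ n) 0) = multiplicity p ((poly F ^^ k) 0)"
  using n
proof (induction n rule: less_induct)
  case (less n)
  let ?A = "\<lambda>n. (poly F ^^ n) 0"
  have F': "poly F z = (\<Prod>i\<in>I. poly (g i) z ^ e i)" for z
    by (simp add: F poly_prod)
  consider "n < k" | "n = k" | "n > k" by linarith
  then show ?case
  proof cases
    case 1
    with min less.prems show ?thesis by blast
  next
    case 2
    then show ?thesis by simp
  next
    case 3
    define v where "v = multiplicity p (?A k)"
    obtain j where j: "k = Suc j" using k(1) by (cases k) auto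
    obtain l where l: "n = l + k" "1 \<le> l" "l < n"
      using 3 k(1) that[of "n - k"] by simp
    have "p dvd ?A n - ?A l"
      using funpow_poly_diff_dvd[of p "?A k" 0 l F] k(2) by (simp add: l funpow_add)
    then have "p dvd ?A l"
      using dvd_diff[OF less.prems(2)] by fastforce
    then have "multiplicity p (?A l) = v"
      unfolding v_def using less.IH l by blast
    then have "p ^ v dvd ?A l - 0"
      using multiplicity_dvd by auto
    then have "p ^ v dvd 0 - ?A l"
      by simp
    then have diff: "p ^ v dvd (poly F ^^ j) 0 - (poly F ^^ j) (?A l)"
      by (rule funpow_poly_diff_dvd)
    have Ak: "?A k = (\<Prod>i\<in>I. poly (g i) (?A j) ^ e i)"
      using F'[of "?A j"] by (simp add: j)
    have "?A n = poly F ((poly F ^^ j) (?A l))"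
      by (simp add: l j funpow_add add.commute[of l])
    then have An: "?A n = (\<Prod>i\<in>I. poly (g i) ((poly F ^^ j) (?A l)) ^ e i)"
      using F' by simp
    show ?thesis
      unfolding Ak An
    proof (rule multiplicity_prod_powers_cong[OF p \<open>finite I\<close> e])
      show "p ^ multiplicity p (\<Prod>i\<in>I. poly (g i) (?A j) ^ e i)
          dvd poly (g i) (?A j) - poly (g i) ((poly F ^^ j) (?A l))" for i
        using poly_diff_dvd[OF diff, of "g i"] unfolding v_def Ak .
    qed (use nz[OF k(1)] nz[OF less.prems(1)] k(2) in \<open>simp_all only: Ak An not_False_eq_True\<close>)
  qed
qed

text \<open>
  Every prime in \<open>A n\<close> has then entered the sequence at some earlier index \<open>k\<close>, and by rigid
  divisibility the one factor \<open>A k\<close> of the product already accounts for its full power in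
  \<open>A n\<close>.
\<close>

lemma orbit_dvd_prod_if_no_primitive_divisor:
  fixes g :: "'i \<Rightarrow> int poly" and F :: "int poly"
  assumes "finite I"
    and e: "\<And>i. i \<in> I \<Longrightarrow> 2 \<le> e i"
    and F: "F = (\<Prod>i\<in>I. g i ^ e i)"
    and nz: "\<And>n. 1 \<le> n \<Longrightarrow> (poly F ^^ n) 0 \<noteq> 0"
    and "1 \<le> n"
    and no_prim: "\<nexists>p. primitive_divisor (\<lambda>n. (poly F ^^ n) 0) n p"
  shows "(poly F ^^ n) 0 dvd (\<Prod>k\<in>{1..<n}. (poly F ^^ k) 0)"
proof (rule multiplicity_le_imp_dvd)
  let ?A = "\<lambda>n. (poly F ^^ n) 0"
  show "?A n \<noteq> 0" using nz \<open>1 \<le> n\<close> .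
  have prod_nz: "(\<Prod>k\<in>{1..<n}. ?A k) \<noteq> 0"
    using nz by simp
  fix p :: int assume p: "prime p"
  show "multiplicity p (?A n) \<le> multiplicity p (\<Prod>k\<in>{1..<n}. ?A k)"
  proof (cases "p dvd ?A n")
    case False
    then show ?thesis by (simp add: not_dvd_imp_multiplicity_0)
  next
    case True
    have "prime (nat p)" "int (nat p) = p"
      using p by (auto simp: prime_ge_0_int)
    then obtain i where i: "1 \<le> i" "i < n" "p dvd ?A i"
      using no_prim True unfolding primitive_divisor_def by metis
    define k where "k = (LEAST k. 1 \<le> k \<and> p dvd ?A k)"
    have k: "1 \<le> k \<and> p dvd ?A k"
      unfolding k_def by (rule LeastI[of _ i]) (use i in simp)
    have "k \<le> i"
      unfolding k_def by (rule Least_le) (use i in simp)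
    have min: "\<not> p dvd ?A j" if "1 \<le> j" "j < k" for j
      using not_less_Least[of j "\<lambda>k. 1 \<le> k \<and> p dvd ?A k"] that by (auto simp: k_def)
    have "multiplicity p (?A n) = multiplicity p (?A k)"
      using multiplicity_orbit_of_zero[OF p \<open>finite I\<close> e F nz _ _ min \<open>1 \<le> n\<close> True] k by blast
    also have "\<dots> \<le> multiplicity p (\<Prod>k\<in>{1..<n}. ?A k)"
    proof (rule dvd_imp_multiplicity_le)
      show "?A k dvd (\<Prod>k\<in>{1..<n}. ?A k)"
        using k \<open>k \<le> i\<close> i by (intro dvd_prodI) auto
    qed (use prod_nz p in \<open>auto simp: not_prime_unit\<close>)
    finally show ?thesis .
  qed
qed

section \<open>Growth\<close>

text \<open>
  Inductively, \<open>A 1 \<cdots> A (n - 1) A n\<close> is smaller than \<open>A n * A n\<close> in absolute value.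
\<close>

lemma prod_less_of_square_growth:
  fixes A :: "nat \<Rightarrow> int"
  assumes A1: "2 \<le> \<bar>A 1\<bar>"
    and growth: "\<And>n. 1 \<le> n \<Longrightarrow> (A n)\<^sup>2 \<le> \<bar>A (Suc n)\<bar>"
    and "1 \<le> n"
  shows "\<bar>\<Prod>k\<in>{1..<n}. A k\<bar> < \<bar>A n\<bar>"
  using \<open>1 \<le> n\<close>
proof (induction n rule: dec_induct)
  case base
  show ?case using A1 by simp
next
  case (step n)
  have "\<bar>\<Prod>k\<in>{1..<Suc n}. A k\<bar> = \<bar>\<Prod>k\<in>{1..<n}. A k\<bar> * \<bar>A n\<bar>"
    using step.hyps by (simp add: prod.atLeastLessThan_Suc abs_mult)
  also have "\<dots> < \<bar>A n\<bar> * \<bar>A n\<bar>"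
    using step.IH by (intro mult_strict_right_mono) auto
  also have "\<dots> \<le> \<bar>A (Suc n)\<bar>"
    using growth[OF step.hyps(1)] by (simp add: power2_eq_square abs_mult_self_eq)
  finally show ?case .
qed

text \<open>
  Both \<open>4 \<le> \<bar>x\<bar>\<close> and \<open>a\<^sup>2 \<le> \<bar>x\<bar>\<close> serve to give \<open>2 * \<bar>a\<bar> \<le> \<bar>x\<bar>\<close>, so subtracting
  \<open>\<bar>a\<bar>\<close> costs at most half of \<open>\<bar>x\<bar>\<close>; and \<open>(\<bar>x\<bar> / 2)\<^sup>2 \<ge> \<bar>x\<bar>\<close> again because \<open>\<bar>x\<bar> \<ge> 4\<close>.
\<close>

lemma square_ge_of_nonzero_multiple:
  fixes x a u :: int
  assumes x: "4 \<le> \<bar>x\<bar>" and a: "a\<^sup>2 \<le> \<bar>x\<bar>" and u: "u \<noteq> 0"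
  shows "\<bar>x\<bar> \<le> (x * u + a)\<^sup>2"
proof -
  have "2 * \<bar>a\<bar> \<le> \<bar>x\<bar>"
  proof (cases "\<bar>a\<bar> \<le> 2")
    case False
    then have "2 * \<bar>a\<bar> \<le> \<bar>a\<bar> * \<bar>a\<bar>" by (intro mult_right_mono) auto
    with a show ?thesis by (simp add: power2_eq_square)
  qed (use x in simp)
  moreover have "\<bar>x\<bar> * 1 \<le> \<bar>x\<bar> * \<bar>u\<bar>"
    using u by (intro mult_left_mono) auto
  moreover have "\<bar>x * u\<bar> \<le> \<bar>x * u + a\<bar> + \<bar>a\<bar>"
    by linarith
  ultimately have half: "\<bar>x\<bar> \<le> 2 * \<bar>x * u + a\<bar>"
    by (simp add: abs_mult)
  have "2 * 2 \<le> 2 * \<bar>x * u + a\<bar>"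
    using order_trans[OF x half] by simp
  then have "2 \<le> \<bar>x * u + a\<bar>"
    by simp
  then have "2 * \<bar>x * u + a\<bar> \<le> \<bar>x * u + a\<bar> * \<bar>x * u + a\<bar>"
    by (intro mult_right_mono) auto
  with half show ?thesis by (simp add: power2_eq_square)
qed

section \<open>Primitive divisors in the orbit of zero\<close>

theorem theorem1p6:
  fixes m :: nat
    and a :: "nat \<Rightarrow> int"
    and e :: "nat \<Rightarrow> nat"
    and f :: "nat \<Rightarrow> int poly"
    and \<phi> :: "int poly"
  assumes "m \<ge> 2"
    and "\<phi> = (\<Prod>i=1..m. ([:0, 1:] * f i + [:a i:]) ^ e i)"
    and "\<exists>j\<in>{1..m}. \<bar>a j\<bar> \<ge> 2"
    and "\<forall>i\<in>{1..m}. e i \<ge> 2"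
    and "\<forall>i\<in>{1..m}. \<forall>k::int. poly (f i) k \<noteq> 0"
  shows "(preperiodic_point (poly \<phi>) 0 \<longleftrightarrow> fixed_point (poly \<phi>) 0) \<and>
    (wandering_point (poly \<phi>) 0 \<longrightarrow>
       zsigmondy_set (\<lambda>n. ((poly \<phi>) ^^ n) 0) = {})"
proof (cases "poly \<phi> 0 = 0")
  case True
  have "(poly \<phi> ^^ n) 0 = 0" for n
    by (induction n) (simp_all add: True)
  then have "forward_orbit (poly \<phi>) 0 = {0}"
    by (auto simp: forward_orbit_def)
  then show ?thesis
    using True by (simp add: preperiodic_point_def wandering_point_def fixed_point_def)
next
  case False
  define A where "A n = (poly \<phi> ^^ n) 0" for n
  note e = assms(4)[rule_format]
  have \<phi>: "poly \<phi> z = (\<Prod>i=1..m. (z * poly (f i) z + a i) ^ e i)" for z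
    by (simp add: assms(2) poly_prod add.commute[of "a _"])
  have A1: "A 1 = (\<Prod>i=1..m. a i ^ e i)"
    by (simp add: A_def \<phi>)
  have a_sq: "(a i)\<^sup>2 \<le> \<bar>A 1\<bar>" if i: "i \<in> {1..m}" for i
  proof -
    have "(a i)\<^sup>2 dvd a i ^ e i"
      using e[OF i] by (rule le_imp_power_dvd)
    also have "\<dots> dvd A 1"
      unfolding A1 using i by (intro dvd_prodI) auto
    finally have "\<bar>(a i)\<^sup>2\<bar> \<le> \<bar>A 1\<bar>"
      by (rule dvd_imp_le_int[rotated]) (use False in \<open>simp add: A_def\<close>)
    then show ?thesis by simp
  qed
  obtain j where j: "j \<in> {1..m}" "2 \<le> \<bar>a j\<bar>"
    using assms(3) by blast
  have "(2::int)\<^sup>2 \<le> \<bar>a j\<bar>\<^sup>2"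
    using j(2) by (rule power_mono) simp
  with a_sq[OF j(1)] have A1_ge: "4 \<le> \<bar>A 1\<bar>"
    by simp
  have square: "x\<^sup>2 \<le> \<bar>poly \<phi> x\<bar>" if x: "\<bar>A 1\<bar> \<le> \<bar>x\<bar>" for x
  proof -
    have factor: "\<bar>x\<bar> \<le> \<bar>x * poly (f i) x + a i\<bar> ^ e i" if i: "i \<in> {1..m}" for i
    proof -
      let ?y = "x * poly (f i) x + a i"
      have "\<bar>x\<bar> \<le> ?y\<^sup>2"
        using A1_ge x a_sq[OF i] assms(5) i by (intro square_ge_of_nonzero_multiple) auto
      moreover from this have "?y \<noteq> 0"
        using A1_ge x by auto
      then have "\<bar>?y\<bar>\<^sup>2 \<le> \<bar>?y\<bar> ^ e i"
        using e[OF i] by (intro power_increasing) auto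
      ultimately show ?thesis by simp
    qed
    have "\<bar>x\<bar>\<^sup>2 \<le> \<bar>x\<bar> ^ m"
      using assms(1) A1_ge x by (intro power_increasing) auto
    also have "\<dots> = (\<Prod>i=1..m. \<bar>x\<bar>)"
      by simp
    also have "\<dots> \<le> (\<Prod>i=1..m. \<bar>x * poly (f i) x + a i\<bar> ^ e i)"
      using factor by (intro prod_mono) auto
    also have "\<dots> = \<bar>poly \<phi> x\<bar>"
      by (simp add: \<phi> abs_prod power_abs)
    finally show ?thesis by simp
  qed
  have A_ge: "\<bar>A 1\<bar> \<le> \<bar>A n\<bar>" if "1 \<le> n" for n
    using that
  proof (induction n rule: dec_induct)
    case (step n)
    have "\<bar>A n\<bar> * 1 \<le> \<bar>A n\<bar> * \<bar>A n\<bar>"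
      using A1_ge step.IH by (intro mult_left_mono) auto
    with square[OF step.IH] step.IH show ?case
      by (simp add: A_def power2_eq_square)
  qed simp
  have growth: "(A n)\<^sup>2 \<le> \<bar>A (Suc n)\<bar>" if "1 \<le> n" for n
    using square[OF A_ge[OF that]] by (simp add: A_def)
  \<comment> \<open>Squares grow strictly because \<open>\<bar>A n\<bar> > 1\<close>, which holds from index 1 on.\<close>
  have "\<bar>A (Suc n)\<bar> < \<bar>A (Suc (Suc n))\<bar>" for n
  proof -
    have "\<bar>A (Suc n)\<bar> * 1 < \<bar>A (Suc n)\<bar> * \<bar>A (Suc n)\<bar>"
      using A1_ge A_ge[of "Suc n"] by (intro mult_strict_left_mono) auto
    with growth[of "Suc n"] show ?thesis by (simp add: power2_eq_square)
  qed
  then have "strict_mono (\<lambda>n. \<bar>A (Suc n)\<bar>)"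
    by (simp add: strict_mono_Suc_iff)
  then have "infinite (range (\<lambda>n. \<bar>A (Suc n)\<bar>))"
    by (simp add: range_inj_infinite strict_mono_imp_inj_on)
  moreover have "range (\<lambda>n. \<bar>A (Suc n)\<bar>) \<subseteq> abs ` forward_orbit (poly \<phi>) 0"
    by (auto simp: forward_orbit_def A_def simp del: funpow.simps)
  ultimately have "wandering_point (poly \<phi>) 0"
    unfolding wandering_point_def by (meson finite_imageI finite_subset)
  moreover have "zsigmondy_set A = {}"
  proof -
    have False if n: "1 \<le> n" and no_prim: "\<nexists>p. primitive_divisor A n p" for n
    proof -
      have nz: "A n \<noteq> 0" if "1 \<le> n" for n
        using A_ge[OF that] A1_ge by auto
      have "A n dvd (\<Prod>k\<in>{1..<n}. A k)"
        unfolding A_def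
        by (rule orbit_dvd_prod_if_no_primitive_divisor[OF _ e assms(2)])
           (use nz n no_prim in \<open>auto simp flip: A_def\<close>)
      then have "\<bar>A n\<bar> \<le> \<bar>\<Prod>k\<in>{1..<n}. A k\<bar>"
        using nz by (intro dvd_imp_le_int) auto
      moreover have "\<bar>\<Prod>k\<in>{1..<n}. A k\<bar> < \<bar>A n\<bar>"
        using A1_ge growth n by (intro prod_less_of_square_growth) auto
      ultimately show False by simp
    qed
    then show ?thesis by (auto simp: zsigmondy_set_def)
  qed
  ultimately show ?thesis
    using False unfolding A_def by (simp add: preperiodic_point_def fixed_point_def)
qed

end
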